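(* Let $x^{*}$ be a sparsest solution (i.e. an optimal solution) of the problem $(P_0)$: $\min_{x\in R^n}\|x\|_0$ subject to $\|y-Ax\|_2\le\epsilon$, $Bx\le b$, where $A\in R^{m\times n}$ and $B\in R^{l\times n}$ have columns $a_i$ $(i=1,\dots,n)$ and $b_i$ $(i=1,\dots,n)$ respectively. Let $S\subseteq\{1,\dots,n\}$ be the support of $x^{*}$. Then $$\mathrm{Null}(A_S)\cap\mathrm{Null}(B_S)=\{0\}.$$
   Context: Data: $A\in R^{m\times n}$, $B\in R^{l\times n}$ with $m\ll n$ (in particular $m<n$) and $l\le n$; $y\in R^m$, $b\in R^l$ are given vectors and $\epsilon\ge 0$ is a given parameter. $\|x\|_0$ is the number of nonzero components of $x$; $\|\cdot\|_2$ is the Euclidean norm; $Bx\le b$ is understood componentwise. The support of $x$ is $\mathrm{supp}(x)=\{i: x_i\ne 0\}$. For an index set $S$, $A_S$ (resp. $B_S$) is the submatrix of $A$ (resp. $B$) consisting of the columns indexed by $S$. $\mathrm{Null}(\cdot)$ denotes the null space of a matrix. *)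

theory Defs
  imports
    "HOL-Analysis.L2_Norm"
    "Jordan_Normal_Form.DL_Submatrix"
    "Jordan_Normal_Form.Matrix_Kernel"
begin

text \<open>Coordinates are numbered from \<open>0\<close>, so \<open>{1,\<dots>,n}\<close> becomes \<open>{0..<n}\<close>.\<close>

definition vec_supp :: "real vec \<Rightarrow> nat set" where
  "vec_supp x = {i. i < dim_vec x \<and> x $ i \<noteq> 0}"

definition l0_norm :: "real vec \<Rightarrow> nat" where
  "l0_norm x = card (vec_supp x)"

definition l2_norm :: "real vec \<Rightarrow> real" where
  "l2_norm v = L2_set (\<lambda>i. v $ i) {..<dim_vec v}"

text \<open>The order on vectors used for \<open>B x \<le> b\<close> is the componentwise one.\<close>

definition P0_feasible ::
  "real mat \<Rightarrow> real mat \<Rightarrow> real vec \<Rightarrow> real vec \<Rightarrow> real \<Rightarrow> real vec set" where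
  "P0_feasible A B y b \<epsilon> =
     {x \<in> carrier_vec (dim_col A). l2_norm (y - A *\<^sub>v x) \<le> \<epsilon> \<and> B *\<^sub>v x \<le> b}"

definition P0_sparsest_solution ::
  "real mat \<Rightarrow> real mat \<Rightarrow> real vec \<Rightarrow> real vec \<Rightarrow> real \<Rightarrow> real vec \<Rightarrow> bool" where
  "P0_sparsest_solution A B y b \<epsilon> x \<longleftrightarrow>
     is_arg_min l0_norm (\<lambda>z. z \<in> P0_feasible A B y b \<epsilon>) x"

text \<open>\<open>A\<^sub>S\<close>: all rows, the columns indexed by \<open>S\<close> in increasing order; its kernel
  therefore consists of vectors of dimension \<open>card S\<close>.\<close>

definition col_submatrix :: "real mat \<Rightarrow> nat set \<Rightarrow> real mat" where
  "col_submatrix A S = submatrix A UNIV S"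

end

theory Submission
  imports Defs
begin

text \<open>A nonzero \<open>v\<close> in both null spaces, padded with zeros outside \<open>S\<close>, gives \<open>z \<noteq> 0\<close>
  with \<open>A z = 0\<close>, \<open>B z = 0\<close> and support inside \<open>S\<close>. Moving from \<open>x\<close> along \<open>z\<close> does not change
  \<open>A x\<close> or \<open>B x\<close>, and a suitable step cancels a coordinate of \<open>x\<close> in \<open>S\<close>, which contradicts
  the minimality of the support.\<close>

text \<open>The index \<open>card {a \<in> S. a < i}\<close> is the rank of \<open>i\<close> in
  \<open>S\<close>. It inverts \<open>pick S\<close>, so the entries of \<open>v\<close> land on the
  columns from which \<open>submatrix\<close> took them.\<close>

definition zero_extend :: "nat \<Rightarrow> nat set \<Rightarrow> 'a::zero vec \<Rightarrow> 'a vec" where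
  "zero_extend n S v = vec n (\<lambda>i. if i \<in> S then v $ card {a \<in> S. a < i} else 0)"

lemma zero_extend_carrier [simp]: "zero_extend n S v \<in> carrier_vec n"
  by (simp add: zero_extend_def)

text \<open>The rank in \<open>S\<close> is a two-sided inverse of \<open>pick S\<close>. This lets
  sums over column positions be rewritten as sums over \<open>S\<close>.\<close>

lemma bij_betw_pick:
  assumes "finite S"
  shows "bij_betw (pick S) {..<card S} S"
proof (rule bij_betwI[where g = "\<lambda>i. card {a \<in> S. a < i}"])
  show "pick S \<in> {..<card S} \<rightarrow> S"
    using pick_in_set_le by auto
  \<comment> \<open>The rank stays strictly below \<open>card S\<close> because \<open>i\<close>
    lies in \<open>S\<close> but not among the elements smaller than \<open>i\<close>.\<close>
  show "(\<lambda>i. card {a \<in> S. a < i}) \<in> S \<rightarrow> {..<card S}"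
    using assms by (auto intro!: psubset_card_mono)
qed (auto simp: card_pick_le pick_card_in_set)

lemma zero_extend_pick:
  assumes "S \<subseteq> {..<n}" and "j < card S"
  shows "zero_extend n S v $ pick S j = v $ j"
  using assms pick_in_set_le[of j S] by (auto simp: zero_extend_def card_pick_le)

lemma submatrix_UNIV_carrier:
  assumes A: "A \<in> carrier_mat m n" and S: "S \<subseteq> {..<n}"
  shows "submatrix A UNIV S \<in> carrier_mat m (card S)"
proof -
  \<comment> \<open>The dimension of a submatrix counts only indices within range; as
    \<open>S\<close> lies within range, that count is \<open>card S\<close>.\<close>
  have "{j. j < n \<and> j \<in> S} = S"
    using S by auto
  then show ?thesis
    using A by (intro carrier_matI) (auto simp: dim_submatrix)
qed

text \<open>Columns outside \<open>S\<close> meet zero coefficients, and the remaining ones are the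
  columns of the submatrix, renumbered by \<open>pick S\<close>.\<close>

lemma mult_zero_extend:
  fixes A :: "'a::semiring_0 mat"
  assumes A: "A \<in> carrier_mat m n" and S: "S \<subseteq> {..<n}" and v: "v \<in> carrier_vec (card S)"
  shows "A *\<^sub>v zero_extend n S v = submatrix A UNIV S *\<^sub>v v"
proof -
  have Sn: "{j. j < n \<and> j \<in> S} = S"
    using S by auto
  have dims: "dim_row (submatrix A UNIV S) = m" "dim_col (submatrix A UNIV S) = card S"
    using submatrix_UNIV_carrier[OF A S] by auto
  have ent: "submatrix A UNIV S $$ (r, j) = A $$ (r, pick S j)" if "r < m" "j < card S" for r j
    using that A Sn submatrix_index[of r A UNIV j S] by (simp add: pick_UNIV)
  have fin: "finite S"
    using S finite_subset by auto
  show ?thesis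
  proof (rule eq_vecI)
    fix r assume "r < dim_vec (submatrix A UNIV S *\<^sub>v v)"
    then have r: "r < m" using dims by simp
    have "(A *\<^sub>v zero_extend n S v) $ r = (\<Sum>i<n. A $$ (r, i) * zero_extend n S v $ i)"
      using A r by (simp add: scalar_prod_def zero_extend_def lessThan_atLeast0)
    also have "\<dots> = (\<Sum>i\<in>S. A $$ (r, i) * zero_extend n S v $ i)"
      using S by (intro sum.mono_neutral_right) (auto simp: zero_extend_def)
    also have "\<dots> = (\<Sum>j<card S. A $$ (r, pick S j) * zero_extend n S v $ pick S j)"
      by (rule sum.reindex_bij_betw[OF bij_betw_pick[OF fin], symmetric])
    also have "\<dots> = (\<Sum>j<card S. submatrix A UNIV S $$ (r, j) * v $ j)"
      using S r by (simp add: zero_extend_pick ent)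
    also have "\<dots> = (submatrix A UNIV S *\<^sub>v v) $ r"
      using r v dims by (simp add: scalar_prod_def lessThan_atLeast0)
    finally show "(A *\<^sub>v zero_extend n S v) $ r = (submatrix A UNIV S *\<^sub>v v) $ r" .
  qed (use A dims in auto)
qed

text \<open>Outside the support of \<open>x\<close> both vectors vanish, so no step along
  \<open>z\<close> creates a new nonzero entry; it remains to choose a step that removes
  one.\<close>

lemma exists_smaller_supp:
  assumes x: "x \<in> carrier_vec n" and z: "z \<in> carrier_vec n"
    and supp: "vec_supp z \<subseteq> vec_supp x" and nz: "z \<noteq> 0\<^sub>v n"
  obtains t where "l0_norm (x - t \<cdot>\<^sub>v z) < l0_norm x"
proof -
  obtain i where i: "i < n" "z $ i \<noteq> 0"
    using z nz by (metis carrier_vecD eq_vecI index_zero_vec)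
  \<comment> \<open>This step length cancels coordinate \<open>i\<close>. Since \<open>z $ i\<close>
    is nonzero, \<open>i\<close> also lies in the support of \<open>x\<close>, so an element is
    really lost.\<close>
  let ?w = "x - (x $ i / z $ i) \<cdot>\<^sub>v z"
  have "vec_supp ?w \<subseteq> vec_supp x"
    using x z supp by (auto simp: vec_supp_def)
  moreover have "i \<in> vec_supp x" "i \<notin> vec_supp ?w"
    using x z supp i by (auto simp: vec_supp_def)
  ultimately have "vec_supp ?w \<subset> vec_supp x"
    by blast
  then have "l0_norm ?w < l0_norm x"
    unfolding l0_norm_def by (intro psubset_card_mono) (auto simp: vec_supp_def)
  then show thesis by (rule that)
qed

lemma mult_minus_smult_kernel:
  fixes A :: "'a::field mat"
  assumes "A \<in> carrier_mat m n" and "x \<in> carrier_vec n" and "z \<in> carrier_vec n"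
    and "A *\<^sub>v z = 0\<^sub>v m"
  shows "A *\<^sub>v (x - t \<cdot>\<^sub>v z) = A *\<^sub>v x"
  using assms by (auto simp: mult_minus_distrib_mat_vec mult_mat_vec)

theorem theorem2p1:
  fixes A B :: "real mat" and y b x :: "real vec" and \<epsilon> :: real
    and m n l :: nat and S :: "nat set"
  assumes "A \<in> carrier_mat m n" and "B \<in> carrier_mat l n"
    and "m < n" and "l \<le> n"
    and "y \<in> carrier_vec m" and "b \<in> carrier_vec l"
    and "\<epsilon> \<ge> 0"
    and "P0_sparsest_solution A B y b \<epsilon> x"
    and "S = vec_supp x"
  shows "mat_kernel (col_submatrix A S) \<inter> mat_kernel (col_submatrix B S) = {0\<^sub>v (card S)}"
proof -
  note A = assms(1) and B = assms(2)
  have feas: "x \<in> P0_feasible A B y b \<epsilon>"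
    and least: "\<And>w. w \<in> P0_feasible A B y b \<epsilon> \<Longrightarrow> \<not> l0_norm w < l0_norm x"
    using assms(8) by (auto simp: P0_sparsest_solution_def is_arg_min_def)
  have x: "x \<in> carrier_vec n"
    using feas A by (simp add: P0_feasible_def)
  have S: "S \<subseteq> {..<n}"
    using x assms(9) by (auto simp: vec_supp_def)
  have AS: "col_submatrix A S \<in> carrier_mat m (card S)"
    and BS: "col_submatrix B S \<in> carrier_mat l (card S)"
    unfolding col_submatrix_def by (rule submatrix_UNIV_carrier[OF A S] submatrix_UNIV_carrier[OF B S])+
  have "v = 0\<^sub>v (card S)"
    if "v \<in> mat_kernel (col_submatrix A S)" "v \<in> mat_kernel (col_submatrix B S)" for v
  proof (rule ccontr)
    assume nz: "v \<noteq> 0\<^sub>v (card S)"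
    have v: "v \<in> carrier_vec (card S)" and vA: "col_submatrix A S *\<^sub>v v = 0\<^sub>v m"
      and vB: "col_submatrix B S *\<^sub>v v = 0\<^sub>v l"
      using that mat_kernelD[OF AS] mat_kernelD[OF BS] by auto
    define z where "z = zero_extend n S v"
    have z: "z \<in> carrier_vec n" and Az: "A *\<^sub>v z = 0\<^sub>v m" and Bz: "B *\<^sub>v z = 0\<^sub>v l"
      using vA vB mult_zero_extend[OF A S v] mult_zero_extend[OF B S v]
      by (auto simp: z_def col_submatrix_def)
    have "vec_supp z \<subseteq> vec_supp x"
      using assms(9) by (auto simp: z_def zero_extend_def vec_supp_def)
    moreover have "z \<noteq> 0\<^sub>v n"
    proof
      assume z0: "z = 0\<^sub>v n"
      obtain j where j: "j < card S" "v $ j \<noteq> 0"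
        using v nz by (metis carrier_vecD eq_vecI index_zero_vec)
      \<comment> \<open>The entry \<open>v $ j\<close> sits in \<open>z\<close> at position
        \<open>pick S j\<close>; the bound is what makes the entry of \<open>0\<^sub>v n\<close>
        there equal to 0.\<close>
      have "pick S j < n"
        using S pick_in_set_le[OF j(1)] by auto
      then show False
        using zero_extend_pick[OF S j(1), of v] j z0 by (simp add: z_def)
    qed
    ultimately obtain t where t: "l0_norm (x - t \<cdot>\<^sub>v z) < l0_norm x"
      using exists_smaller_supp[OF x z] by blast
    \<comment> \<open>Both constraints depend on the vector only through its images under
      \<open>A\<close> and \<open>B\<close>, which the step leaves unchanged.\<close>
    have "x - t \<cdot>\<^sub>v z \<in> P0_feasible A B y b \<epsilon>"
      using feas x z A mult_minus_smult_kernel[OF A x z Az] mult_minus_smult_kernel[OF B x z Bz]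
      by (simp add: P0_feasible_def)
    with t least show False by blast
  qed
  moreover have "0\<^sub>v (card S) \<in> mat_kernel (col_submatrix A S)"
    "0\<^sub>v (card S) \<in> mat_kernel (col_submatrix B S)"
    using AS BS by (auto intro!: mat_kernelI)
  ultimately show ?thesis by blast
qed

end
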